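(* Let $\Omega\subseteq\mathbb{R}^n$ be open with $0\in\Omega$, let $g,h\colon\Omega\to\mathbb{R}^n$ be locally Lipschitz and let $Q\in L^1(\mathbb{R};\mathbb{R}^{n\times n})$. Define the operator $G(u)=g(u)+Q*h(u)$ and assume that it takes values in $L^1(\mathbb{R};\mathbb{R}^n)$, i.e. $G(u)\in L^1(\mathbb{R};\mathbb{R}^n)$ for all $u\in L^1(\mathbb{R};\Omega)$ of sufficiently small total variation. Then there exist a positive $\delta_o$ and positive constants $L_1,L_2$ such that $G\colon\mathcal{U}_{\delta_o}\to L^1(\mathbb{R};\mathbb{R}^n)$ satisfies $$\|G(u)-G(w)\|_{L^1}\le L_1\,\|u-w\|_{L^1}\quad\text{for all }u,w\in\mathcal{U}_{\delta_o},\qquad \mathrm{TV}(G(u))\le L_2\,\mathrm{TV}(u)\quad\text{for all }u\in\mathcal{U}_{\delta_o}.$$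
   Context: For $\delta>0$, $\mathcal{U}_\delta=\{u\in L^1(\mathbb{R};\Omega)\colon \mathrm{TV}(u)\le\delta\}$, where $\mathrm{TV}$ denotes total variation on $\mathbb{R}$. The convolution is $(Q*h(u))(x)=\int_{\mathbb{R}}Q(y)\,h(u(x-y))\,dy$, and $g(u)$ denotes the function $x\mapsto g(u(x))$. *)

theory Defs
  imports "HOL-Analysis.Analysis"
begin

(* Elements of L^1 are represented by functions, not by classes modulo null sets; hence values
   are constrained only almost everywhere, and "lebesgue" (rather than "lborel") is used so that
   any modification on a null set stays admissible. *)
definition L1_space :: "'a::{banach, second_countable_topology} set \<Rightarrow> (real \<Rightarrow> 'a) set" where
  "L1_space S = {u. integrable lebesgue u \<and> (AE x in lebesgue. u x \<in> S)}"

definition L1_norm :: "(real \<Rightarrow> 'a::{banach, second_countable_topology}) \<Rightarrow> real" where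
  "L1_norm u = (LINT x|lebesgue. norm (u x))"

definition pointwise_variation :: "(real \<Rightarrow> 'a::real_normed_vector) \<Rightarrow> ennreal" where
  "pointwise_variation u =
     (SUP (t, N) \<in> {(t :: nat \<Rightarrow> real, N :: nat). mono t}.
        ennreal (\<Sum>i<N. norm (u (t (Suc i)) - u (t i))))"

(* The total variation of the class of u modulo null sets: the least pointwise variation over
   all representatives. *)
definition TV :: "(real \<Rightarrow> 'a::real_normed_vector) \<Rightarrow> ennreal" where
  "TV u = (INF v \<in> {v. AE x in lebesgue. v x = u x}. pointwise_variation v)"

definition small_TV ::
  "'a::{banach, second_countable_topology} set \<Rightarrow> real \<Rightarrow> (real \<Rightarrow> 'a) set" where
  "small_TV \<Omega> \<delta> = {u \<in> L1_space \<Omega>. TV u \<le> ennreal \<delta>}"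

(* The first argument of local_lipschitz is a time parameter, on which f does not depend. *)
definition locally_lipschitz_on ::
  "'a::metric_space set \<Rightarrow> ('a \<Rightarrow> 'b::metric_space) \<Rightarrow> bool" where
  "locally_lipschitz_on X f \<longleftrightarrow> local_lipschitz (UNIV :: real set) X (\<lambda>_. f)"

definition convolve :: "(real \<Rightarrow> real^'n^'m) \<Rightarrow> (real \<Rightarrow> real^'n) \<Rightarrow> real \<Rightarrow> real^'m" where
  "convolve Q f x = (LINT y|lebesgue. Q y *v f (x - y))"

(* The Bochner integral is 0 for a non-integrable integrand, so convolve is a genuine
   convolution at x only under this condition. *)
definition convolution_exists_at ::
  "(real \<Rightarrow> real^'n^'m) \<Rightarrow> (real \<Rightarrow> real^'n) \<Rightarrow> real \<Rightarrow> bool" where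
  "convolution_exists_at Q f x \<longleftrightarrow> integrable lebesgue (\<lambda>y. Q y *v f (x - y))"

definition G_op ::
  "(real^'n \<Rightarrow> real^'n) \<Rightarrow> (real^'n \<Rightarrow> real^'n) \<Rightarrow> (real \<Rightarrow> real^'n^'n)
    \<Rightarrow> (real \<Rightarrow> real^'n) \<Rightarrow> real \<Rightarrow> real^'n" where
  "G_op g h Q u x = g (u x) + convolve Q (\<lambda>z. h (u z)) x"

(* G(u) is defined (almost everywhere) and lies in L^1, for all u in U. *)
definition G_maps_into_L1 ::
  "(real^'n \<Rightarrow> real^'n) \<Rightarrow> (real^'n \<Rightarrow> real^'n) \<Rightarrow> (real \<Rightarrow> real^'n^'n)
    \<Rightarrow> (real \<Rightarrow> real^'n) set \<Rightarrow> bool" where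
  "G_maps_into_L1 g h Q U \<longleftrightarrow>
     (\<forall>u\<in>U. (AE x in lebesgue. convolution_exists_at Q (\<lambda>z. h (u z)) x) \<and>
            G_op g h Q u \<in> L1_space UNIV)"

end

theory Submission
  imports Defs
begin

text \<open>
  Fix a ball around the origin on which \<open>g\<close> and \<open>h\<close> are Lipschitz.  An integrable function on the
  line comes arbitrarily close to \<open>0\<close>, so its supremum norm is at most its pointwise variation;
  hence a \<open>u\<close> of small total variation has a representative \<open>v\<close> all of whose values lie in that
  ball.  The estimate in \<open>L\<^sup>1\<close> is then Young's inequality for \<open>Q * (h(v) - h(w))\<close>.  For the variation,
  the sum over a partition is moved under the integral of the convolution, where for every \<open>y\<close> it
  runs over the partition translated by \<open>y\<close>.
\<close>

section \<open>Pointwise variation and its control of the supremum norm\<close>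

lemma pointwise_variation_ge:
  assumes "mono t"
  shows "ennreal (\<Sum>i<N. norm (u (t (Suc i)) - u (t i))) \<le> pointwise_variation u"
  unfolding pointwise_variation_def using assms by (intro SUP_upper2[of "(t, N)"]) auto

lemma pointwise_variation_leI:
  assumes "\<And>t N. mono t \<Longrightarrow> (\<Sum>i<N. norm (u (t (Suc i)) - u (t i))) \<le> V"
  shows "pointwise_variation u \<le> ennreal V"
  unfolding pointwise_variation_def using assms by (intro SUP_least) (auto intro!: ennreal_leI)

lemma norm_diff_le_variation:
  fixes v :: "real \<Rightarrow> 'a::real_normed_vector"
  assumes "pointwise_variation v \<le> ennreal V" "0 \<le> V"
  shows "norm (v x - v y) \<le> V"
proof -
  \<comment> \<open>The partition with a single increment. Partitions have to be monotone, so the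
    two points are ordered by \<open>min\<close> and \<open>max\<close>.\<close>
  define t where "t = (\<lambda>i::nat. if i = 0 then min x y else max x y)"
  have "mono t"
    by (auto simp: t_def mono_def)
  then have "ennreal (\<Sum>i<1. norm (v (t (Suc i)) - v (t i))) \<le> ennreal V"
    using pointwise_variation_ge assms(1) order_trans by blast
  then have "norm (v (max x y) - v (min x y)) \<le> V"
    using assms(2) by (simp add: t_def)
  then show ?thesis
    by (cases "x \<le> y") (auto simp: max_def min_def norm_minus_commute split: if_splits)
qed

text \<open>If \<open>norm (v x)\<close> exceeded \<open>V\<close>, the norm of every value of
  \<open>v\<close> would be at least a fixed \<open>c > 0\<close>, and a nonzero constant would be
  integrable over the whole line. The bound therefore holds at every point, not just almost
  everywhere.\<close>

lemma norm_le_variation: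
  fixes v :: "real \<Rightarrow> 'a::{banach, second_countable_topology}"
  assumes "integrable lebesgue v" "pointwise_variation v \<le> ennreal V" "0 \<le> V"
  shows "norm (v x) \<le> V"
proof (rule ccontr)
  assume "\<not> norm (v x) \<le> V"
  define c where "c = norm (v x) - V"
  have "c > 0" using \<open>\<not> norm (v x) \<le> V\<close> by (simp add: c_def)
  have "norm c \<le> norm (v y)" for y
    using norm_diff_le_variation[OF assms(2,3), of x y] norm_triangle_ineq2[of "v x" "v y"] \<open>c > 0\<close>
    by (simp add: c_def)
  then have "integrable lebesgue (\<lambda>_::real. c)"
    by (intro Bochner_Integration.integrable_bound[OF assms(1)]) auto
  then show False
    using \<open>c > 0\<close> by (auto simp: integrable_iff_bounded ennreal_mult_eq_top_iff)
qed

section \<open>Reflections, and convolution of nonnegative functions\<close>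

text \<open>The exceptional set lies in a Borel null set, and an affine change of variables
  preserves null sets of \<open>lborel\<close>.\<close>

lemma AE_lebesgue_reflect:
  fixes x :: real
  assumes "AE y in lebesgue. P y"
  shows "AE y in lebesgue. P (x - y)"
proof -
  from assms have "AE y in lborel. P y"
    by (simp add: AE_completion_iff)
  then obtain N where N: "N \<in> null_sets lborel" "{y. \<not> P y} \<subseteq> N"
    by (auto elim!: AE_E simp: null_sets_def)
  have [measurable]: "N \<in> sets borel"
    using N(1) by (auto simp: null_sets_def)
  have "AE y in lborel. x + (-1) * y \<notin> N"
    using AE_not_in[OF N(1)] by (intro AE_borel_affine) auto
  then have "AE y in lborel. P (x - y)"
    by eventually_elim (use N(2) in auto)
  then show ?thesis
    by (rule AE_completion)
qed

lemma borel_measurable_lebesgue_reflect: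
  fixes f :: "real \<Rightarrow> 'b::euclidean_space"
  assumes "f \<in> borel_measurable lebesgue"
  shows "(\<lambda>y. f (x - y)) \<in> borel_measurable lebesgue"
  using borel_measurable_affine[OF assms, of "-1" x] by simp

text \<open>Tonelli and translation invariance. Both functions are first replaced by Borel
  representatives, for which the integrand is jointly measurable in \<open>x\<close> and
  \<open>y\<close>.\<close>

lemma nn_integral_convolution:
  fixes q f :: "real \<Rightarrow> ennreal"
  assumes q: "q \<in> borel_measurable lebesgue" and f: "f \<in> borel_measurable lebesgue"
  shows "(\<integral>\<^sup>+x. \<integral>\<^sup>+y. q y * f (x - y) \<partial>lebesgue \<partial>lebesgue) =
         (\<integral>\<^sup>+y. q y \<partial>lebesgue) * (\<integral>\<^sup>+y. f y \<partial>lebesgue)"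
proof -
  obtain q' where q' [measurable]: "q' \<in> borel_measurable lborel" and qq': "AE y in lborel. q y = q' y"
    using completion_ex_borel_measurable[OF q] by auto
  obtain f' where f' [measurable]: "f' \<in> borel_measurable lborel" and ff': "AE y in lborel. f y = f' y"
    using completion_ex_borel_measurable[OF f] by auto
  \<comment> \<open>For each fixed \<open>x\<close> the exceptional set of \<open>f\<close> is only
    reflected and shifted, so the inner integrals agree for every \<open>x\<close>.\<close>
  have "AE y in lborel. q y * f (x - y) = q' y * f' (x - y)" for x
  proof -
    have "AE y in lborel. f (x - y) = f' (x - y)"
      using AE_lebesgue_reflect[of "\<lambda>y. f y = f' y" x] ff' by (simp add: AE_completion_iff)
    with qq' show ?thesis by eventually_elim simp
  qed
  then have "(\<integral>\<^sup>+x. \<integral>\<^sup>+y. q y * f (x - y) \<partial>lborel \<partial>lborel)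
      = (\<integral>\<^sup>+x. \<integral>\<^sup>+y. q' y * f' (x - y) \<partial>lborel \<partial>lborel)"
    by (intro nn_integral_cong nn_integral_cong_AE)
  also have "\<dots> = (\<integral>\<^sup>+y. \<integral>\<^sup>+x. q' y * f' (x - y) \<partial>lborel \<partial>lborel)"
    by (rule lborel_pair.Fubini') measurable
  also have "\<dots> = (\<integral>\<^sup>+y. q' y * (\<integral>\<^sup>+x. f' x \<partial>lborel) \<partial>lborel)"
  proof (intro nn_integral_cong)
    fix y
    have "(\<integral>\<^sup>+x. q' y * f' (x - y) \<partial>lborel) = q' y * (\<integral>\<^sup>+x. f' (x - y) \<partial>lborel)"
      by (rule nn_integral_cmult) measurable
    also have "(\<integral>\<^sup>+x. f' (x - y) \<partial>lborel) = (\<integral>\<^sup>+x. f' x \<partial>lborel)"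
      using nn_integral_real_affine[of f' 1 "-y"] by simp
    finally show "(\<integral>\<^sup>+x. q' y * f' (x - y) \<partial>lborel) = q' y * (\<integral>\<^sup>+x. f' x \<partial>lborel)" .
  qed
  also have "\<dots> = (\<integral>\<^sup>+y. q' y \<partial>lborel) * (\<integral>\<^sup>+x. f' x \<partial>lborel)"
    by (rule nn_integral_multc) measurable
  also have "(\<integral>\<^sup>+y. q' y \<partial>lborel) = (\<integral>\<^sup>+y. q y \<partial>lborel)"
    using qq' by (intro nn_integral_cong_AE) auto
  also have "(\<integral>\<^sup>+y. f' y \<partial>lborel) = (\<integral>\<^sup>+y. f y \<partial>lborel)"
    using ff' by (intro nn_integral_cong_AE) auto
  finally show ?thesis
    by (simp add: nn_integral_completion)
qed

section \<open>Matrix-valued convolution\<close>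

text \<open>Here \<open>norm A\<close> is the Frobenius norm, the Euclidean norm of the row norms;
  Cauchy-Schwarz is applied to each row.\<close>

lemma norm_matrix_vector_mult_le:
  fixes A :: "real^'n^'m"
  shows "norm (A *v x) \<le> norm A * norm x"
proof -
  have "norm (A *v x) \<le> L2_set (\<lambda>i. norm (A $ i) * norm x) UNIV"
    unfolding norm_vec_def[of "A *v x"]
    by (intro L2_set_mono) (auto simp: matrix_vector_mul_component Cauchy_Schwarz_ineq2)
  also have "\<dots> = norm A * norm x"
    by (simp add: L2_set_left_distrib norm_vec_def[of A])
  finally show ?thesis .
qed

text \<open>Supplies the joint continuity from which measurability of
  \<open>Q y *v f (x - y)\<close> is derived.\<close>

lemma bounded_bilinear_matrix_vector_mult:
  "bounded_bilinear ((*v) :: real^'n^'m \<Rightarrow> real^'n \<Rightarrow> real^'m)"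
  by standard
    (auto simp: matrix_vector_mult_add_rdistrib matrix_vector_right_distrib scaleR_matrix_vector_assoc
        matrix_vector_mult_scaleR intro!: exI[of _ 1] norm_matrix_vector_mult_le)

lemma borel_measurable_matrix_vector_mult:
  fixes Q :: "'a \<Rightarrow> real^'n^'m"
  assumes "Q \<in> borel_measurable M" "f \<in> borel_measurable M"
  shows "(\<lambda>x. Q x *v f x) \<in> borel_measurable M"
  using assms
  by (rule borel_measurable_continuous_Pair)
    (intro bounded_bilinear.continuous_on[OF bounded_bilinear_matrix_vector_mult] continuous_intros)

text \<open>The integrand is dominated by \<open>norm (Q y) * B\<close>. Existence at every
  \<open>x\<close>, rather than almost every \<open>x\<close>, matters because the variation
  evaluates the convolution at arbitrary partition points.\<close>

lemma convolution_exists_bounded: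
  fixes Q :: "real \<Rightarrow> real^'n^'m"
  assumes Q: "integrable lebesgue Q" and f: "f \<in> borel_measurable lebesgue"
    and B: "\<And>z. norm (f z) \<le> B"
  shows "convolution_exists_at Q f x"
  unfolding convolution_exists_at_def
proof (rule Bochner_Integration.integrable_bound)
  show "integrable lebesgue (\<lambda>y. norm (Q y) * B)"
    using Q by simp
  show "(\<lambda>y. Q y *v f (x - y)) \<in> borel_measurable lebesgue"
    using Q f by (intro borel_measurable_matrix_vector_mult borel_measurable_lebesgue_reflect) auto
  have "norm (Q y *v f (x - y)) \<le> norm (norm (Q y) * B)" for y
  proof -
    have "norm (Q y *v f (x - y)) \<le> norm (Q y) * norm (f (x - y))"
      by (rule norm_matrix_vector_mult_le)
    also have "\<dots> \<le> norm (Q y) * B"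
      by (intro mult_left_mono B) auto
    finally show ?thesis by simp
  qed
  then show "AE y in lebesgue. norm (Q y *v f (x - y)) \<le> norm (norm (Q y) * B)"
    by simp
qed

lemma convolve_cong_AE:
  fixes Q :: "real \<Rightarrow> real^'n^'m"
  assumes Q: "integrable lebesgue Q" and f: "f \<in> borel_measurable lebesgue"
    and ff': "AE x in lebesgue. f x = f' x"
  shows "convolve Q f x = convolve Q f' x"
  unfolding convolve_def
proof (rule integral_cong_AE)
  have "f' \<in> borel_measurable lebesgue"
    using f ff' by (rule borel_measurable_AE)
  then show "(\<lambda>y. Q y *v f' (x - y)) \<in> borel_measurable lebesgue"
    and "(\<lambda>y. Q y *v f (x - y)) \<in> borel_measurable lebesgue"
    using Q f by (auto intro!: borel_measurable_matrix_vector_mult borel_measurable_lebesgue_reflect)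
  show "AE y in lebesgue. Q y *v f (x - y) = Q y *v f' (x - y)"
    using AE_lebesgue_reflect[OF ff', of x] by eventually_elim simp
qed

text \<open>Two base points allow two uses: different functions at one point for the
  \<open>L1\<close> estimate, and one function at consecutive partition points for the
  variation.\<close>

lemma convolve_diff:
  assumes "convolution_exists_at Q f x" "convolution_exists_at Q f' x'"
  shows "convolve Q f x - convolve Q f' x' = (LINT y|lebesgue. Q y *v (f (x - y) - f' (x' - y)))"
  using assms unfolding convolution_exists_at_def convolve_def
  by (simp add: matrix_vector_mult_diff_distrib)

text \<open>Young's inequality for a difference. In the application \<open>f\<close> and
  \<open>f'\<close> are compositions with \<open>h\<close>, which need not be integrable when
  \<open>h 0\<close> is nonzero; hence the existence of both convolutions is assumed and the bound
  is phrased with nonnegative integrals.\<close>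

lemma nn_integral_convolve_diff_le:
  fixes Q :: "real \<Rightarrow> real^'n^'m"
  assumes Q: "integrable lebesgue Q"
    and f: "f \<in> borel_measurable lebesgue" and f': "f' \<in> borel_measurable lebesgue"
    and ex: "\<And>x. convolution_exists_at Q f x" "\<And>x. convolution_exists_at Q f' x"
  shows "(\<integral>\<^sup>+x. norm (convolve Q f x - convolve Q f' x) \<partial>lebesgue)
     \<le> (\<integral>\<^sup>+x. norm (Q x) \<partial>lebesgue) * (\<integral>\<^sup>+x. norm (f x - f' x) \<partial>lebesgue)"
proof -
  have "ennreal (norm (convolve Q f x - convolve Q f' x))
      \<le> (\<integral>\<^sup>+y. ennreal (norm (Q y)) * ennreal (norm (f (x - y) - f' (x - y))) \<partial>lebesgue)" for x
  proof -
    have "integrable lebesgue (\<lambda>y. Q y *v (f (x - y) - f' (x - y)))"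
      using ex[of x] by (simp add: convolution_exists_at_def matrix_vector_mult_diff_distrib)
    then have "ennreal (norm (convolve Q f x - convolve Q f' x))
        \<le> (\<integral>\<^sup>+y. norm (Q y *v (f (x - y) - f' (x - y))) \<partial>lebesgue)"
      by (simp add: convolve_diff ex integral_norm_bound_ennreal)
    also have "\<dots> \<le> (\<integral>\<^sup>+y. ennreal (norm (Q y)) * ennreal (norm (f (x - y) - f' (x - y))) \<partial>lebesgue)"
      by (intro nn_integral_mono) (simp add: ennreal_mult[symmetric] norm_matrix_vector_mult_le)
    finally show ?thesis .
  qed
  then have "(\<integral>\<^sup>+x. norm (convolve Q f x - convolve Q f' x) \<partial>lebesgue)
     \<le> (\<integral>\<^sup>+x. \<integral>\<^sup>+y. ennreal (norm (Q y)) * ennreal (norm (f (x - y) - f' (x - y))) \<partial>lebesgue \<partial>lebesgue)"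
    by (intro nn_integral_mono)
  also have "\<dots> = (\<integral>\<^sup>+x. norm (Q x) \<partial>lebesgue) * (\<integral>\<^sup>+x. norm (f x - f' x) \<partial>lebesgue)"
    using Q f f' by (intro nn_integral_convolution[of _ "\<lambda>z. ennreal (norm (f z - f' z))"]) auto
  finally show ?thesis .
qed

section \<open>Variation of \<open>G_op g h Q v\<close>\<close>

lemma variation_G_op_le:
  fixes Q :: "real \<Rightarrow> real^'n^'n"
  assumes Q: "integrable lebesgue Q"
    and g: "Lg-lipschitz_on S g" and h: "Lh-lipschitz_on S h" and v: "\<And>x. v x \<in> S"
    and ex: "\<And>x. convolution_exists_at Q (\<lambda>z. h (v z)) x"
    and V: "pointwise_variation v \<le> ennreal V" "0 \<le> V"
  shows "pointwise_variation (G_op g h Q v) \<le> ennreal ((Lg + L1_norm Q * Lh) * V)"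
proof (rule pointwise_variation_leI)
  fix t :: "nat \<Rightarrow> real" and N
  assume t: "mono t"
  \<comment> \<open>Stated for every monotone \<open>s\<close> because it is applied to
    \<open>t\<close> and also to each translate of \<open>t\<close> by \<open>y\<close>.\<close>
  have sum_le: "(\<Sum>i<N. norm (v (s (Suc i)) - v (s i))) \<le> V" if "mono s" for s
    using order_trans[OF pointwise_variation_ge[OF that] V(1)] V(2) by (simp add: ennreal_le_iff)
  define d where "d = (\<lambda>i y. h (v (t (Suc i) - y)) - h (v (t i - y)))"
  have int: "integrable lebesgue (\<lambda>y. norm (Q y *v d i y))" for i
    using ex[of "t i"] ex[of "t (Suc i)"]
    by (simp add: d_def convolution_exists_at_def matrix_vector_mult_diff_distrib)
  have Gd: "norm (G_op g h Q v (t (Suc i)) - G_op g h Q v (t i))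
      \<le> Lg * norm (v (t (Suc i)) - v (t i)) + (LINT y|lebesgue. norm (Q y *v d i y))" for i
  proof -
    have "norm (G_op g h Q v (t (Suc i)) - G_op g h Q v (t i))
        = norm (g (v (t (Suc i))) - g (v (t i)) + (LINT y|lebesgue. Q y *v d i y))"
      using convolve_diff[OF ex[of "t (Suc i)"] ex[of "t i"]]
      by (simp add: G_op_def d_def algebra_simps)
    also have "\<dots> \<le> norm (g (v (t (Suc i))) - g (v (t i))) + norm (LINT y|lebesgue. Q y *v d i y)"
      by (rule norm_triangle_ineq)
    also have "\<dots> \<le> Lg * norm (v (t (Suc i)) - v (t i)) + (LINT y|lebesgue. norm (Q y *v d i y))"
      using lipschitz_on_normD[OF g v v] by (intro add_mono integral_norm_bound) auto
    finally show ?thesis .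
  qed
  \<comment> \<open>Summing under the integral before estimating keeps the bound independent of
    \<open>N\<close>.\<close>
  have "(\<Sum>i<N. (LINT y|lebesgue. norm (Q y *v d i y))) = (LINT y|lebesgue. (\<Sum>i<N. norm (Q y *v d i y)))"
    using int by (simp add: Bochner_Integration.integral_sum)
  also have "\<dots> \<le> (LINT y|lebesgue. norm (Q y) * (Lh * V))"
  proof (rule integral_mono)
    show "integrable lebesgue (\<lambda>y. \<Sum>i<N. norm (Q y *v d i y))"
      using int by auto
    show "integrable lebesgue (\<lambda>y. norm (Q y) * (Lh * V))"
      using Q by auto
    fix y
    have "(\<Sum>i<N. norm (Q y *v d i y))
        \<le> (\<Sum>i<N. norm (Q y) * (Lh * norm (v (t (Suc i) - y) - v (t i - y))))"
      unfolding d_def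
      by (intro sum_mono order_trans[OF norm_matrix_vector_mult_le] mult_left_mono
          lipschitz_on_normD[OF h] v) auto
    also have "\<dots> = norm (Q y) * (Lh * (\<Sum>i<N. norm (v (t (Suc i) - y) - v (t i - y))))"
      by (simp add: sum_distrib_left)
    also have "\<dots> \<le> norm (Q y) * (Lh * V)"
      using t lipschitz_on_nonneg[OF h]
      by (intro mult_left_mono sum_le[of "\<lambda>i. t i - y"]) (auto simp: mono_def)
    finally show "(\<Sum>i<N. norm (Q y *v d i y)) \<le> norm (Q y) * (Lh * V)" .
  qed
  also have "\<dots> = L1_norm Q * Lh * V"
    by (simp add: L1_norm_def)
  finally have conv: "(\<Sum>i<N. (LINT y|lebesgue. norm (Q y *v d i y))) \<le> L1_norm Q * Lh * V" .
  have "(\<Sum>i<N. norm (G_op g h Q v (t (Suc i)) - G_op g h Q v (t i)))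
      \<le> (\<Sum>i<N. Lg * norm (v (t (Suc i)) - v (t i)) + (LINT y|lebesgue. norm (Q y *v d i y)))"
    by (intro sum_mono Gd)
  also have "\<dots> = Lg * (\<Sum>i<N. norm (v (t (Suc i)) - v (t i)))
      + (\<Sum>i<N. (LINT y|lebesgue. norm (Q y *v d i y)))"
    by (simp add: sum.distrib sum_distrib_left)
  also have "\<dots> \<le> Lg * V + L1_norm Q * Lh * V"
    using lipschitz_on_nonneg[OF g] by (intro add_mono mult_left_mono sum_le t conv)
  finally show "(\<Sum>i<N. norm (G_op g h Q v (t (Suc i)) - G_op g h Q v (t i)))
      \<le> (Lg + L1_norm Q * Lh) * V"
    by (simp add: algebra_simps)
qed

section \<open>Localisation to a ball and choice of representatives\<close>

text \<open>Local Lipschitz continuity only speaks of a ball intersected with \<open>X\<close>;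
  openness lets the radius shrink until the ball lies inside \<open>X\<close>.\<close>

lemma locally_lipschitz_on_cball:
  assumes "locally_lipschitz_on X f" "open X" "a \<in> X"
  obtains r L where "r > 0" "L-lipschitz_on (cball a r) f"
proof -
  obtain u L where "u > 0" and L: "L-lipschitz_on (cball a u \<inter> X) f"
    using assms(1,3) unfolding locally_lipschitz_on_def local_lipschitz_def
    by (metis UNIV_I centre_in_cball inf_top.right_neutral less_imp_le)
  obtain e where "e > 0" "cball a e \<subseteq> X"
    using assms(2,3) open_contains_cball by blast
  then have "cball a (min u e) \<subseteq> cball a u \<inter> X"
    by auto
  with L have "L-lipschitz_on (cball a (min u e)) f"
    by (rule lipschitz_on_subset)
  with \<open>u > 0\<close> \<open>e > 0\<close> show thesis
    by (intro that[of "min u e"]) auto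
qed

text \<open>Nothing is known about \<open>f\<close> off \<open>S\<close>, so the composition passes
  through the Borel space restricted to \<open>S\<close>, on which \<open>f\<close> is
  continuous.\<close>

lemma borel_measurable_lipschitz_compose:
  fixes f :: "'a::real_normed_vector \<Rightarrow> 'b::real_normed_vector"
  assumes "L-lipschitz_on S f" "S \<in> sets borel" "v \<in> borel_measurable M" "\<And>x. v x \<in> S"
  shows "(\<lambda>x. f (v x)) \<in> borel_measurable M"
proof -
  have "v \<in> M \<rightarrow>\<^sub>M restrict_space borel S"
    using assms(3,4) by (intro measurable_restrict_space2) auto
  moreover have "f \<in> borel_measurable (restrict_space borel S)"
    by (intro borel_measurable_continuous_on_restrict lipschitz_on_continuous_on[OF assms(1)])
  ultimately show ?thesis
    by (rule measurable_compose)
qed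

text \<open>The strict inequality yields a representative of variation below \<open>V\<close>
  without any claim that the infimum in \<open>TV\<close> is attained;
  \<open>norm_le_variation\<close> then confines all its values.\<close>

lemma small_TV_representative:
  fixes u :: "real \<Rightarrow> 'a::euclidean_space"
  assumes u: "integrable lebesgue u" and V: "TV u < ennreal V" "0 \<le> V"
  obtains v where "integrable lebesgue v" "AE x in lebesgue. u x = v x"
    "pointwise_variation v \<le> ennreal V" "\<And>x. v x \<in> cball 0 V"
proof -
  obtain v where ae: "AE x in lebesgue. v x = u x" and pv: "pointwise_variation v < ennreal V"
    using V(1) unfolding TV_def INF_less_iff by auto
  from ae have ae': "AE x in lebesgue. u x = v x"
    by eventually_elim simp
  moreover have "integrable lebesgue v"
    using u borel_measurable_AE[OF _ ae'] ae' by (subst integrable_cong_AE[OF _ _ ae]) auto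
  ultimately show thesis
    using norm_le_variation[of v V] pv V(2) by (intro that[of v]) auto
qed

lemma G_op_cong_AE:
  fixes Q :: "real \<Rightarrow> real^'n^'n"
  assumes Q: "integrable lebesgue Q" and h: "(\<lambda>x. h (v x)) \<in> borel_measurable lebesgue"
    and ae: "AE x in lebesgue. u x = v x"
  shows "AE x in lebesgue. G_op g h Q u x = G_op g h Q v x"
proof -
  have "AE x in lebesgue. h (v x) = h (u x)"
    using ae by eventually_elim simp
  then have "convolve Q (\<lambda>z. h (v z)) x = convolve Q (\<lambda>z. h (u z)) x" for x
    by (intro convolve_cong_AE Q h)
  with ae show ?thesis
    by (auto simp: G_op_def)
qed

section \<open>The \<open>L1\<close> Lipschitz estimate\<close>

lemma L1_norm_G_op_diff_le:
  fixes Q :: "real \<Rightarrow> real^'n^'n"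
  assumes Q: "integrable lebesgue Q"
    and g: "Lg-lipschitz_on S g" and h: "Lh-lipschitz_on S h" and S: "S \<in> sets borel"
    and v: "integrable lebesgue v" "\<And>x. v x \<in> S" and w: "integrable lebesgue w" "\<And>x. w x \<in> S"
    and ex: "\<And>x. convolution_exists_at Q (\<lambda>z. h (v z)) x"
      "\<And>x. convolution_exists_at Q (\<lambda>z. h (w z)) x"
    and G: "integrable lebesgue (G_op g h Q v)" "integrable lebesgue (G_op g h Q w)"
  shows "L1_norm (\<lambda>x. G_op g h Q v x - G_op g h Q w x)
    \<le> (Lg + L1_norm Q * Lh) * L1_norm (\<lambda>x. v x - w x)"
proof -
  let ?gd = "\<lambda>x. g (v x) - g (w x)"
  let ?hd = "\<lambda>x. h (v x) - h (w x)"
  let ?cd = "\<lambda>x. convolve Q (\<lambda>z. h (v z)) x - convolve Q (\<lambda>z. h (w z)) x"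
  let ?D = "L1_norm (\<lambda>x. v x - w x)"
  have L1: "(\<integral>\<^sup>+x. ennreal (norm (f x)) \<partial>lebesgue) = ennreal (L1_norm f)"
    if "integrable lebesgue f" for f :: "real \<Rightarrow> 'b::{banach, second_countable_topology}"
    using that by (simp add: L1_norm_def nn_integral_eq_integral)
  have nonneg: "0 \<le> Lg" "0 \<le> Lh" "0 \<le> L1_norm Q" "0 \<le> ?D"
    using g h by (auto simp: L1_norm_def lipschitz_on_nonneg)
  have [measurable]: "(\<lambda>x. g (v x)) \<in> borel_measurable lebesgue" "(\<lambda>x. g (w x)) \<in> borel_measurable lebesgue"
    using v w by (auto intro!: borel_measurable_lipschitz_compose[OF g S])
  have hm: "(\<lambda>x. h (v x)) \<in> borel_measurable lebesgue" "(\<lambda>x. h (w x)) \<in> borel_measurable lebesgue"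
    using v w by (auto intro!: borel_measurable_lipschitz_compose[OF h S])
  have [measurable]: "G_op g h Q v \<in> borel_measurable lebesgue" "G_op g h Q w \<in> borel_measurable lebesgue"
    using G by auto
  have lip: "(\<integral>\<^sup>+x. ennreal (norm (f (v x) - f (w x))) \<partial>lebesgue) \<le> ennreal (L * ?D)"
    if f: "L-lipschitz_on S f" for L f
  proof -
    have "(\<integral>\<^sup>+x. ennreal (norm (f (v x) - f (w x))) \<partial>lebesgue)
        \<le> (\<integral>\<^sup>+x. ennreal L * ennreal (norm (v x - w x)) \<partial>lebesgue)"
      using lipschitz_on_normD[OF f v(2) w(2)] lipschitz_on_nonneg[OF f]
      by (intro nn_integral_mono) (simp add: ennreal_mult[symmetric] ennreal_leI)
    also have "\<dots> = ennreal (L * ?D)"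
      using v(1) w(1) lipschitz_on_nonneg[OF f] nonneg(4)
      by (simp add: nn_integral_cmult L1 ennreal_mult)
    finally show ?thesis .
  qed
  \<comment> \<open>Measurability of the convolution difference is read off from this identity,
    since both \<open>G_op\<close> terms are integrable by assumption and the \<open>g\<close> terms
    are measurable.\<close>
  have cd: "?cd x = (G_op g h Q v x - G_op g h Q w x) - ?gd x" for x
    by (simp add: G_op_def)
  have cd_measurable: "(\<lambda>x. ennreal (norm (?cd x))) \<in> borel_measurable lebesgue"
    by (subst cd) measurable
  have "ennreal (L1_norm (\<lambda>x. G_op g h Q v x - G_op g h Q w x))
      = (\<integral>\<^sup>+x. norm (?gd x + ?cd x) \<partial>lebesgue)"
    using G by (simp add: L1[symmetric] cd)
  also have "\<dots> \<le> (\<integral>\<^sup>+x. ennreal (norm (?gd x)) + ennreal (norm (?cd x)) \<partial>lebesgue)"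
    by (intro nn_integral_mono) (simp add: ennreal_plus[symmetric] norm_triangle_ineq del: ennreal_plus)
  also have "\<dots> = (\<integral>\<^sup>+x. norm (?gd x) \<partial>lebesgue) + (\<integral>\<^sup>+x. norm (?cd x) \<partial>lebesgue)"
    by (rule nn_integral_add[OF _ cd_measurable]) measurable
  also have "\<dots> \<le> ennreal (Lg * ?D) + ennreal (L1_norm Q) * ennreal (Lh * ?D)"
  proof (intro add_mono lip g)
    have "(\<integral>\<^sup>+x. norm (?cd x) \<partial>lebesgue)
        \<le> (\<integral>\<^sup>+x. norm (Q x) \<partial>lebesgue) * (\<integral>\<^sup>+x. norm (?hd x) \<partial>lebesgue)"
      by (intro nn_integral_convolve_diff_le Q hm ex)
    also have "\<dots> \<le> ennreal (L1_norm Q) * ennreal (Lh * ?D)"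
      unfolding L1[OF Q] by (intro mult_left_mono lip h) auto
    finally show "(\<integral>\<^sup>+x. norm (?cd x) \<partial>lebesgue) \<le> ennreal (L1_norm Q) * ennreal (Lh * ?D)" .
  qed
  also have "\<dots> = ennreal ((Lg + L1_norm Q * Lh) * ?D)"
    using nonneg by (simp add: ennreal_mult[symmetric] ennreal_plus[symmetric] algebra_simps del: ennreal_plus)
  finally show ?thesis
    using nonneg by (simp add: ennreal_le_iff)
qed

section \<open>Choice of constants and passage to representatives\<close>

theorem proposition1p1:
  fixes \<Omega> :: "(real^'n) set"
    and g h :: "real^'n \<Rightarrow> real^'n"
    and Q :: "real \<Rightarrow> real^'n^'n"
  assumes "open \<Omega>" and "0 \<in> \<Omega>"
    and "locally_lipschitz_on \<Omega> g" and "locally_lipschitz_on \<Omega> h"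
    and "Q \<in> L1_space UNIV"
    and "\<exists>\<delta>>0. G_maps_into_L1 g h Q (small_TV \<Omega> \<delta>)"
  shows "\<exists>\<delta>\<^sub>o>0. \<exists>L\<^sub>1>0. \<exists>L\<^sub>2>0.
           G_maps_into_L1 g h Q (small_TV \<Omega> \<delta>\<^sub>o) \<and>
           (\<forall>u\<in>small_TV \<Omega> \<delta>\<^sub>o. \<forall>w\<in>small_TV \<Omega> \<delta>\<^sub>o.
              L1_norm (\<lambda>x. G_op g h Q u x - G_op g h Q w x) \<le> L\<^sub>1 * L1_norm (\<lambda>x. u x - w x)) \<and>
           (\<forall>u\<in>small_TV \<Omega> \<delta>\<^sub>o. TV (G_op g h Q u) \<le> ennreal L\<^sub>2 * TV u)"
proof -
  obtain r1 Lg where r1: "r1 > 0" and g1: "Lg-lipschitz_on (cball 0 r1) g"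
    using locally_lipschitz_on_cball assms(1-3) by blast
  obtain r2 Lh where r2: "r2 > 0" and h2: "Lh-lipschitz_on (cball 0 r2) h"
    using locally_lipschitz_on_cball assms(1,2,4) by blast
  obtain \<delta> where \<delta>: "\<delta> > 0" and G\<delta>: "G_maps_into_L1 g h Q (small_TV \<Omega> \<delta>)"
    using assms(6) by blast
  define r where "r = min r1 r2"
  \<comment> \<open>Halving \<open>r\<close> makes \<open>TV u\<close> strictly smaller than
    \<open>r\<close>, as \<open>small_TV_representative\<close> requires.\<close>
  define \<delta>\<^sub>o where "\<delta>\<^sub>o = min \<delta> (r / 2)"
  \<comment> \<open>The summand 1 makes \<open>L\<close> positive even if both Lipschitz constants
    vanish. The same \<open>L\<close> serves as \<open>L\<^sub>1\<close> and as
    \<open>L\<^sub>2\<close>.\<close>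
  define L where "L = Lg + L1_norm Q * Lh + 1"
  let ?B = "cball (0 :: real^'n) r"
  have r: "r > 0" and \<delta>o: "\<delta>\<^sub>o > 0" "\<delta>\<^sub>o \<le> \<delta>" "\<delta>\<^sub>o < r"
    using r1 r2 \<delta> by (auto simp: r_def \<delta>\<^sub>o_def)
  have g: "Lg-lipschitz_on ?B g" and h: "Lh-lipschitz_on ?B h"
    using g1 h2 by (auto simp: r_def intro: lipschitz_on_subset)
  have Q: "integrable lebesgue Q"
    using assms(5) by (simp add: L1_space_def)
  have C: "0 \<le> Lg + L1_norm Q * Lh"
    using lipschitz_on_nonneg[OF g] lipschitz_on_nonneg[OF h] by (simp add: L1_norm_def)
  have G: "G_maps_into_L1 g h Q (small_TV \<Omega> \<delta>\<^sub>o)"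
    using G\<delta> \<delta>o(2) unfolding G_maps_into_L1_def small_TV_def
    by (auto intro: order_trans[OF _ ennreal_leI])
  have hm: "(\<lambda>x. h (v x)) \<in> borel_measurable lebesgue"
    if "integrable lebesgue v" "\<And>x. v x \<in> ?B" for v
    using that by (intro borel_measurable_lipschitz_compose[OF h]) auto
  have ex: "convolution_exists_at Q (\<lambda>z. h (v z)) x"
    if v: "integrable lebesgue v" "\<And>x. v x \<in> ?B" for v x
  proof (rule convolution_exists_bounded[OF Q hm[OF v]])
    fix z
    have "norm (h (v z) - h 0) \<le> Lh * norm (v z - 0)"
      using r v(2)[of z] by (intro lipschitz_on_normD[OF h]) auto
    also have "\<dots> \<le> Lh * r"
      using v(2)[of z] lipschitz_on_nonneg[OF h] by (intro mult_left_mono) auto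
    finally show "norm (h (v z)) \<le> norm (h 0) + Lh * r"
      using norm_triangle_ineq2[of "h (v z)" "h 0"] by simp
  qed
  \<comment> \<open>Integrability of \<open>G_op g h Q v\<close> is inherited from \<open>u\<close>,
    since the two images agree almost everywhere.\<close>
  have rep: "\<exists>v. integrable lebesgue v \<and> (AE x in lebesgue. u x = v x) \<and> (\<forall>x. v x \<in> ?B) \<and>
      integrable lebesgue (G_op g h Q v) \<and> (AE x in lebesgue. G_op g h Q u x = G_op g h Q v x)"
    if u: "u \<in> small_TV \<Omega> \<delta>\<^sub>o" for u
  proof -
    have "integrable lebesgue u" "TV u < ennreal r"
      using u r \<delta>o by (auto simp: small_TV_def L1_space_def ennreal_lessI intro: le_less_trans)
    then obtain v where v: "integrable lebesgue v" "AE x in lebesgue. u x = v x" "\<And>x. v x \<in> ?B"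
      using small_TV_representative[of u r] r by (metis less_imp_le)
    have "integrable lebesgue (G_op g h Q u)"
      using G u by (auto simp: G_maps_into_L1_def L1_space_def)
    moreover have ae: "AE x in lebesgue. G_op g h Q u x = G_op g h Q v x"
      by (intro G_op_cong_AE Q hm v)
    moreover from calculation have "G_op g h Q v \<in> borel_measurable lebesgue"
      using borel_measurable_AE borel_measurable_integrable by blast
    ultimately have "integrable lebesgue (G_op g h Q v)"
      using integrable_cong_AE[OF _ _ ae] by (simp add: borel_measurable_integrable)
    with v ae show ?thesis by blast
  qed
  have L1_cong: "L1_norm (\<lambda>x. a x - b x) = L1_norm (\<lambda>x. a' x - b' x)"
    if "integrable lebesgue a'" "integrable lebesgue b'"
      "AE x in lebesgue. a x = a' x" "AE x in lebesgue. b x = b' x"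
    for a b a' b' :: "real \<Rightarrow> real^'n"
  proof -
    have ae: "AE x in lebesgue. norm (a' x - b' x) = norm (a x - b x)"
      using that(3,4) by eventually_elim simp
    have m: "(\<lambda>x. norm (a' x - b' x)) \<in> borel_measurable lebesgue"
      using that(1,2) by auto
    from integral_cong_AE[OF m borel_measurable_AE[OF m ae] ae] show ?thesis
      by (simp add: L1_norm_def)
  qed
  have "L1_norm (\<lambda>x. G_op g h Q u x - G_op g h Q w x) \<le> L * L1_norm (\<lambda>x. u x - w x)"
    if u: "u \<in> small_TV \<Omega> \<delta>\<^sub>o" and w: "w \<in> small_TV \<Omega> \<delta>\<^sub>o" for u w
  proof -
    obtain v where v: "integrable lebesgue v" "AE x in lebesgue. u x = v x" "\<And>x. v x \<in> ?B"
      "integrable lebesgue (G_op g h Q v)" "AE x in lebesgue. G_op g h Q u x = G_op g h Q v x"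
      using rep[OF u] by blast
    obtain z where z: "integrable lebesgue z" "AE x in lebesgue. w x = z x" "\<And>x. z x \<in> ?B"
      "integrable lebesgue (G_op g h Q z)" "AE x in lebesgue. G_op g h Q w x = G_op g h Q z x"
      using rep[OF w] by blast
    have "L1_norm (\<lambda>x. G_op g h Q v x - G_op g h Q z x)
        \<le> (Lg + L1_norm Q * Lh) * L1_norm (\<lambda>x. v x - z x)"
      by (intro L1_norm_G_op_diff_le[OF Q g h] ex v z) auto
    also have "\<dots> \<le> L * L1_norm (\<lambda>x. v x - z x)"
      by (intro mult_right_mono) (auto simp: L_def L1_norm_def)
    finally show ?thesis
      using L1_cong[OF v(4) z(4) v(5) z(5)] L1_cong[OF v(1) z(1) v(2) z(2)] by simp
  qed
  moreover have "TV (G_op g h Q u) \<le> ennreal L * TV u" if u: "u \<in> small_TV \<Omega> \<delta>\<^sub>o" for u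
  \<comment> \<open>Representatives are only available with variation bounds strictly above
    \<open>TV u\<close>, hence the slack \<open>e\<close>.\<close>
  proof (rule ennreal_le_epsilon)
    fix e :: real
    assume "e > 0"
    have int: "integrable lebesgue u" and le: "TV u \<le> ennreal \<delta>\<^sub>o"
      using u by (auto simp: small_TV_def L1_space_def)
    then obtain T where T: "TV u = ennreal T" "0 \<le> T"
      by (metis ennreal_cases ennreal_less_top leD top.not_eq_extremum)
    \<comment> \<open>Strictly above \<open>T\<close>, so that a representative exists; at most
      \<open>r\<close>, so that its values stay in the Lipschitz ball; and close enough to
      \<open>T\<close> that multiplying by \<open>L\<close> costs at most \<open>e\<close>.\<close>
    define V where "V = min r (T + e / L)"
    have "T < r"
      using le T \<delta>o by (simp add: ennreal_le_iff)
    moreover have "L > 0"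
      using C by (simp add: L_def)
    ultimately have V: "T < V" "V \<le> r" "L * V \<le> L * T + e"
      using \<open>e > 0\<close> by (auto simp: V_def min_def field_simps)
    obtain v where v: "integrable lebesgue v" "AE x in lebesgue. u x = v x"
      "pointwise_variation v \<le> ennreal V" "\<And>x. v x \<in> cball 0 V"
      using small_TV_representative[OF int, of V] V T by (auto simp: ennreal_lessI)
    have vB: "v x \<in> ?B" for x
      using v(4)[of x] V(2) by auto
    have "AE x in lebesgue. G_op g h Q u x = G_op g h Q v x"
      by (intro G_op_cong_AE Q hm v vB)
    then have "AE x in lebesgue. G_op g h Q v x = G_op g h Q u x"
      by eventually_elim simp
    \<comment> \<open>\<open>G_op g h Q v\<close> is itself a competitor in the infimum that defines
      the left-hand side.\<close>
    then have "TV (G_op g h Q u) \<le> pointwise_variation (G_op g h Q v)"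
      unfolding TV_def by (intro INF_lower) simp
    also have "\<dots> \<le> ennreal ((Lg + L1_norm Q * Lh) * V)"
      using V T v vB by (intro variation_G_op_le[OF Q g h]) (auto intro: ex)
    also have "\<dots> \<le> ennreal (L * V)"
      using V T by (intro ennreal_leI mult_right_mono) (auto simp: L_def)
    also have "\<dots> \<le> ennreal (L * T + e)"
      using V by (intro ennreal_leI)
    also have "\<dots> = ennreal L * TV u + ennreal e"
      using T \<open>L > 0\<close> \<open>e > 0\<close> by (simp add: ennreal_mult)
    finally show "TV (G_op g h Q u) \<le> ennreal L * TV u + ennreal e" .
  qed
  moreover have "L > 0"
    using C by (simp add: L_def)
  ultimately show ?thesis
    using G \<delta>o(1) by blast
qed

end
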